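(* Let $A\in\mathbb{C}^{n\times n}$ be a power nonnegative matrix such that $A^m$ is nonnegative and irreducible for some $m\ge\nu(A)$. Let $x,y>0$ be vectors such that $Ax=\lambda_1(A)x$ and $y^{T}A=\lambda_1(A)y^{T}$. Then $$\frac{1}{1+k}\sum_{s=0}^{k}\lambda_1(A)^{-s}A^s\;\longrightarrow\;\frac{xy^{T}}{x^{T}y}>O\qquad (k\to\infty).$$
   Context: $M\ge O$ (nonnegative), respectively $M>O$ (positive), means that all entries of $M$ are real and $\ge0$, respectively $>0$; similarly for vectors. $A$ is power nonnegative if $A^k\ge O$ for some integer $k\ge1$, and then $\nu(A)=\min\{k\ge1: A^k\ge O\}$. $\rho(A)$ is the spectral radius. $\lambda_1(A)$ is the eigenvalue $\lambda$ of $A$ of modulus $\rho(A)$ with $\lambda^m=\rho(A)^m$ (under the hypotheses there is exactly one; it is nonzero and has positive right and left eigenvectors). A square matrix $A$ is reducible if there is a permutation matrix $P$ such that $PAP^{T}=\begin{pmatrix} X & O \\ W & Y \end{pmatrix}$ with square diagonal blocks $X,Y$; otherwise irreducible; the $1\times1$ zero matrix is not regarded as irreducible. *)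

theory Defs
  imports "Jordan_Normal_Form.Spectral_Radius"
begin

definition nonneg_mat :: "complex mat \<Rightarrow> bool" where
  "nonneg_mat M \<longleftrightarrow>
     (\<forall>i < dim_row M. \<forall>j < dim_col M. M $$ (i, j) \<in> \<real> \<and> 0 \<le> Re (M $$ (i, j)))"

definition pos_mat :: "complex mat \<Rightarrow> bool" where
  "pos_mat M \<longleftrightarrow>
     (\<forall>i < dim_row M. \<forall>j < dim_col M. M $$ (i, j) \<in> \<real> \<and> 0 < Re (M $$ (i, j)))"

definition pos_vec :: "complex vec \<Rightarrow> bool" where
  "pos_vec v \<longleftrightarrow> (\<forall>i < dim_vec v. v $ i \<in> \<real> \<and> 0 < Re (v $ i))"

definition power_nonneg :: "complex mat \<Rightarrow> bool" where
  "power_nonneg A \<longleftrightarrow> (\<exists>k \<ge> 1. nonneg_mat (A ^\<^sub>m k))"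

(* Meaningful only if A is power nonnegative. *)
definition nu :: "complex mat \<Rightarrow> nat" where
  "nu A = (LEAST k. 1 \<le> k \<and> nonneg_mat (A ^\<^sub>m k))"

definition permutation_mat :: "nat \<Rightarrow> complex mat \<Rightarrow> bool" where
  "permutation_mat n P \<longleftrightarrow>
     (\<exists>p. p permutes {..<n} \<and> P = mat n n (\<lambda>(i, j). if j = p i then 1 else 0))"

(* Both diagonal blocks are nonempty; otherwise every matrix would be reducible. *)
definition reducible_mat :: "complex mat \<Rightarrow> bool" where
  "reducible_mat A \<longleftrightarrow>
     (\<exists>P X W Y r s.
        0 < r \<and> 0 < s \<and>
        A \<in> carrier_mat (r + s) (r + s) \<and> permutation_mat (r + s) P \<and>
        X \<in> carrier_mat r r \<and> W \<in> carrier_mat s r \<and> Y \<in> carrier_mat s s \<and>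
        P * A * transpose_mat P = four_block_mat X (0\<^sub>m r s) W Y)"

definition irreducible_mat :: "complex mat \<Rightarrow> bool" where
  "irreducible_mat A \<longleftrightarrow> square_mat A \<and> \<not> reducible_mat A \<and> A \<noteq> 0\<^sub>m 1 1"

(* The exponent m is the one for which A^m is assumed nonnegative and irreducible;
   this assumption guarantees that the described eigenvalue exists and is unique. *)
definition lambda1 :: "nat \<Rightarrow> complex mat \<Rightarrow> complex" where
  "lambda1 m A =
     (THE z. eigenvalue A z \<and> cmod z = spectral_radius A \<and>
             z ^ m = complex_of_real (spectral_radius A) ^ m)"

(* Matrices of the AFP type carry no topology: convergence is that of the entries,
   for matrices of one fixed size. *)
definition mat_tendsto :: "(nat \<Rightarrow> complex mat) \<Rightarrow> complex mat \<Rightarrow> bool" where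
  "mat_tendsto F L \<longleftrightarrow>
     (\<forall>k. F k \<in> carrier_mat (dim_row L) (dim_col L)) \<and>
     (\<forall>i < dim_row L. \<forall>j < dim_col L. (\<lambda>k. F k $$ (i, j)) \<longlonglongrightarrow> L $$ (i, j))"

(* The library has no notation for a sum of a family of matrices other than the
   abelian-group sum of the module of n by n matrices. *)
abbreviation mat_sum :: "nat \<Rightarrow> (nat \<Rightarrow> complex mat) \<Rightarrow> nat set \<Rightarrow> complex mat" where
  "mat_sum n f S \<equiv> finsum (module_mat TYPE(complex) n n) f S"

(* The matrix x y^T, a column times a row. *)
definition outer_mat :: "complex vec \<Rightarrow> complex vec \<Rightarrow> complex mat" where
  "outer_mat x y = mat_of_cols (dim_vec x) [x] * mat_of_row y"

end

theory Submission
  imports Defs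
begin

text \<open>
Write \<open>\<lambda>\<close> for the eigenvalue in question. Comparing signs in \<open>A\<^sup>m x = \<lambda>\<^sup>m x\<close>, where \<open>x\<close> is positive
and \<open>A\<^sup>m\<close> is nonnegative and irreducible, shows that \<open>\<lambda>\<^sup>m\<close> is a positive real number
(\<open>positive_eigenvector_eigenvalue_pos\<close>). Hence \<open>C = A / \<lambda>\<close> makes sense, \<open>C\<^sup>m\<close> is nonnegative,
and \<open>x\<close>, \<open>y\<close> are a right and a left fixed vector of \<open>C\<close>. The claim is the mean ergodic theorem
for \<open>C\<close> with limit the projection \<open>J = x y\<^sup>T / (x\<^sup>T y)\<close>, and it rests on three facts.

First, \<open>C\<close> has bounded powers. A nonnegative matrix that fixes a positive vector has bounded
powers because its powers fix the same vector
(\<open>nonneg_positive_fixed_vector_power_bounded\<close>). This applies to \<open>C\<^sup>m\<close>, and every power of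
\<open>C\<close> is a power of \<open>C\<^sup>m\<close> times one of finitely many matrices.

Second, every fixed vector of \<open>C\<close> is a multiple of \<open>x\<close>. It is an eigenvector of \<open>A\<^sup>m\<close> for
\<open>\<lambda>\<^sup>m\<close>, and this eigenspace is spanned by \<open>x\<close>. This is the elementary part of the
Perron-Frobenius theorem (\<open>irreducible_eigenspace_one_dimensional\<close>): the zero entries of a
nonnegative eigenvector form a set of indices that the matrix respects, so that irreducibility
leaves only the empty set and the full set.

Third, by the second fact \<open>N = I - C + J\<close> is invertible, and with \<open>Z = N\<^sup>-\<^sup>1\<close> one has
\<open>(I - C) Z = I - J\<close>. Multiplying by \<open>C\<^sup>s\<close> and summing, the sum telescopes:
the sum of \<open>C\<^sup>s\<close> for \<open>s \<le> k\<close> equals \<open>(k + 1) J + Z - C\<^sup>k\<^sup>+\<^sup>1 Z\<close>. By boundedness of the powers,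
division by \<open>k + 1\<close> leaves \<open>J\<close> in the limit (\<open>cesaro_mean_tendsto_projection\<close>).
\<close>

section \<open>Positive eigenvectors of irreducible nonnegative matrices\<close>

text \<open>
Moving the indices in \<open>S\<close> to the front by a permutation turns the vanishing of the entries with row
index in \<open>S\<close> and column index outside \<open>S\<close> into the zero block of the definition of reducibility.
Irreducibility enters every later argument through this combinatorial form.
\<close>

lemma reducible_mat_if_closed_index_set:
  assumes M: "M \<in> carrier_mat n n"
    and S: "S \<subseteq> {..<n}" "S \<noteq> {}" "S \<noteq> {..<n}"
    and closed: "\<And>i j. i \<in> S \<Longrightarrow> j < n \<Longrightarrow> j \<notin> S \<Longrightarrow> M $$ (i, j) = 0"
  shows "reducible_mat M"
proof -
  define T where "T = {..<n} - S"
  define xs where "xs = sorted_list_of_set S @ sorted_list_of_set T"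
  define p where "p i = (if i < n then xs ! i else i)" for i
  define r s where "r = card S" and "s = card T"
  have fin: "finite S" "finite T" using S by (auto simp: T_def intro: finite_subset)
  have "0 < r" "0 < s" using S fin by (auto simp: r_def s_def T_def card_gt_0_iff)
  have n: "n = r + s"
    using S card_mono[of "{..<n}" S] by (simp add: r_def s_def T_def card_Diff_subset fin(1))
  have len: "length xs = n" by (simp add: xs_def n r_def s_def)
  have "set xs = {..<n}" using S fin by (auto simp: xs_def T_def)
  moreover have "distinct xs" using fin by (auto simp: xs_def T_def)
  ultimately have "bij_betw ((!) xs) {..<n} {..<n}"
    by (intro bij_betw_nth) (simp_all add: len)
  then have "bij_betw p {..<n} {..<n}"
    by (subst bij_betw_cong[where g = "(!) xs"]) (simp_all add: p_def)
  then have p: "p permutes {..<n}"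
    by (rule bij_imp_permutes) (simp add: p_def)
  have p_lt: "p i < n" if "i < n" for i using permutes_in_image[OF p] that by auto
  have p_S: "p i \<in> S" if "i < r" for i
  proof -
    have "p i = sorted_list_of_set S ! i"
      using that n by (simp add: p_def xs_def nth_append r_def)
    moreover have "i < length (sorted_list_of_set S)" using that by (simp add: r_def)
    ultimately have "p i \<in> set (sorted_list_of_set S)" by (metis nth_mem)
    then show ?thesis using fin by simp
  qed
  have p_T: "p i \<notin> S" if "r \<le> i" "i < n" for i
  proof -
    have "p i = sorted_list_of_set T ! (i - r)"
      using that n by (simp add: p_def xs_def nth_append r_def)
    moreover have "i - r < length (sorted_list_of_set T)" using that n by (simp add: s_def)
    ultimately have "p i \<in> set (sorted_list_of_set T)" by (metis nth_mem)
    then show ?thesis using fin by (simp add: T_def)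
  qed
  define P :: "complex mat" where "P = mat n n (\<lambda>(i, j). if j = p i then 1 else 0)"
  define Q where "Q = P * M * transpose_mat P"
  have P: "P \<in> carrier_mat n n" by (simp add: P_def)
  have PM: "(P * M) $$ (i, j) = M $$ (p i, j)" if "i < n" "j < n" for i j
  proof -
    have "(P * M) $$ (i, j) = (\<Sum>k = 0..<n. (if k = p i then 1 else 0) * M $$ (k, j))"
      using that M by (simp add: P_def scalar_prod_def)
    also have "\<dots> = (\<Sum>k = 0..<n. if k = p i then M $$ (k, j) else 0)"
      by (intro sum.cong) auto
    finally show ?thesis using p_lt[OF that(1)] by simp
  qed
  have Q: "Q $$ (i, j) = M $$ (p i, p j)" if "i < n" "j < n" for i j
  proof -
    have "Q $$ (i, j) = (\<Sum>k = 0..<n. (P * M) $$ (i, k) * (if k = p j then 1 else 0))"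
      using that M P unfolding Q_def by (simp add: scalar_prod_def P_def del: index_mult_mat(1))
        (simp add: scalar_prod_def)
    also have "\<dots> = (\<Sum>k = 0..<n. if k = p j then M $$ (p i, k) else 0)"
      using that PM by (intro sum.cong) auto
    finally show ?thesis using p_lt[OF that(2)] by simp
  qed
  have "permutation_mat (r + s) P"
    unfolding permutation_mat_def using p by (auto simp: P_def n)
  moreover have "Q = four_block_mat (mat r r (\<lambda>(i, j). Q $$ (i, j))) (0\<^sub>m r s)
      (mat s r (\<lambda>(i, j). Q $$ (i + r, j))) (mat s s (\<lambda>(i, j). Q $$ (i + r, j + r)))"
  proof (rule eq_matI, goal_cases)
    case (1 i j)
    then have ij: "i < n" "j < n" by (simp_all add: n)
    have "Q $$ (i, j) = 0" if "i < r" "\<not> j < r"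
      using Q[OF ij] closed p_S p_T p_lt ij that by simp
    then show ?case using 1 by auto
  qed (use P M n in \<open>auto simp: Q_def\<close>)
  ultimately show ?thesis
    unfolding reducible_mat_def Q_def
    using \<open>0 < r\<close> \<open>0 < s\<close> M n by (blast intro: mat_carrier)
qed

text \<open>
Subtract from \<open>w\<close> the largest multiple of \<open>x\<close> that leaves a nonnegative vector \<open>u\<close>. Then \<open>u\<close> is again
an eigenvector and has a zero entry. In a row \<open>i\<close> with \<open>u i = 0\<close> the eigenvalue equation says that
a sum of nonnegative terms vanishes, so \<open>B\<close> has no entry from the zero set of \<open>u\<close> into its support;
by irreducibility the support is empty.
\<close>

lemma irreducible_positive_eigenvector_unique:
  fixes x w :: "nat \<Rightarrow> real"
  assumes B: "B \<in> carrier_mat n n" "nonneg_mat B" "\<not> reducible_mat B"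
    and n: "0 < n"
    and x: "\<And>i. i < n \<Longrightarrow> 0 < x i"
    and eig_x: "\<And>i. i < n \<Longrightarrow> (\<Sum>j<n. Re (B $$ (i, j)) * x j) = \<mu> * x i"
    and eig_w: "\<And>i. i < n \<Longrightarrow> (\<Sum>j<n. Re (B $$ (i, j)) * w j) = \<mu> * w i"
  shows "\<exists>c. \<forall>i<n. w i = c * x i"
proof -
  define c where "c = Min ((\<lambda>i. w i / x i) ` {..<n})"
  define u where "u i = w i - c * x i" for i
  define S where "S = {i. i < n \<and> u i = 0}"
  have u_nonneg: "0 \<le> u i" if "i < n" for i
  proof -
    have "c \<le> w i / x i" using that by (auto simp: c_def intro!: Min_le)
    then show ?thesis using x[OF that] by (simp add: u_def field_simps)
  qed
  have "c \<in> (\<lambda>i. w i / x i) ` {..<n}" unfolding c_def using n by (intro Min_in) auto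
  then obtain i0 where "i0 < n" "c = w i0 / x i0" by auto
  then have "i0 \<in> S" using x[of i0] by (simp add: S_def u_def)
  have closed: "B $$ (i, j) = 0" if "i \<in> S" "j < n" "j \<notin> S" for i j
  proof -
    have i: "i < n" "u i = 0" using that by (auto simp: S_def)
    have nn: "0 \<le> Re (B $$ (i, k)) * u k" if "k < n" for k
      using B(1,2) i that u_nonneg by (auto simp: nonneg_mat_def)
    have "(\<Sum>k<n. Re (B $$ (i, k)) * u k) = \<mu> * u i"
      using eig_x[OF i(1)] eig_w[OF i(1)]
      by (simp add: u_def algebra_simps sum_subtractf flip: sum_distrib_left)
    then have "Re (B $$ (i, j)) * u j = 0"
      using sum_nonneg_0[of "{..<n}" "\<lambda>k. Re (B $$ (i, k)) * u k" j] i(2) nn that(2) by simp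
    moreover have "u j \<noteq> 0" using that by (simp add: S_def)
    moreover have "B $$ (i, j) \<in> \<real>" using B(1,2) i that by (auto simp: nonneg_mat_def)
    ultimately show ?thesis by (simp add: complex_eq_iff complex_is_Real_iff)
  qed
  have "S = {..<n}"
    using reducible_mat_if_closed_index_set[OF B(1), of S] B(3) closed \<open>i0 \<in> S\<close>
    by (auto simp: S_def)
  then have "\<forall>i<n. w i = c * x i" by (auto simp: S_def u_def)
  then show ?thesis ..
qed

lemma index_mult_mat_vec_sum:
  assumes "M \<in> carrier_mat n n" "v \<in> carrier_vec n" "i < n"
  shows "(M *\<^sub>v v) $ i = (\<Sum>j<n. M $$ (i, j) * v $ j)"
  using assms by (auto simp: scalar_prod_def lessThan_atLeast0 intro!: sum.cong)

text \<open>
The matrix, \<open>x\<close> and \<open>\<mu>\<close> are real, so the real and the imaginary part of a complex eigenvector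
satisfy the same eigenvalue equation and can be compared with \<open>x\<close> separately.
\<close>

lemma irreducible_eigenspace_one_dimensional:
  assumes B: "B \<in> carrier_mat n n" "nonneg_mat B" "\<not> reducible_mat B"
    and x: "x \<in> carrier_vec n" "pos_vec x" "B *\<^sub>v x = complex_of_real \<mu> \<cdot>\<^sub>v x"
    and v: "v \<in> carrier_vec n" "B *\<^sub>v v = complex_of_real \<mu> \<cdot>\<^sub>v v"
  shows "\<exists>c. v = c \<cdot>\<^sub>v x"
proof (cases "n = 0")
  case True
  then show ?thesis using x v by (intro exI[of _ 0] eq_vecI) auto
next
  case False
  then have n: "0 < n" by simp
  have B_real: "Im (B $$ (i, j)) = 0" if "i < n" "j < n" for i j
    using B that by (auto simp: nonneg_mat_def complex_is_Real_iff)
  have x_real: "Im (x $ i) = 0" "0 < Re (x $ i)" if "i < n" for i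
    using x that by (auto simp: pos_vec_def complex_is_Real_iff)
  have entry: "(\<Sum>j<n. B $$ (i, j) * z $ j) = \<mu> * z $ i"
    if "z \<in> carrier_vec n" "B *\<^sub>v z = complex_of_real \<mu> \<cdot>\<^sub>v z" "i < n" for z i
    using index_mult_mat_vec_sum[OF B(1) that(1,3)] that by simp
  have Re: "(\<Sum>j<n. Re (B $$ (i, j)) * Re (z $ j)) = \<mu> * Re (z $ i)"
    and Im: "(\<Sum>j<n. Re (B $$ (i, j)) * Im (z $ j)) = \<mu> * Im (z $ i)"
    if "z \<in> carrier_vec n" "B *\<^sub>v z = complex_of_real \<mu> \<cdot>\<^sub>v z" "i < n" for z i
    using arg_cong[OF entry[OF that], of Re] arg_cong[OF entry[OF that], of Im] that(3)
    by (simp_all add: B_real)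
  obtain a where a: "\<And>i. i < n \<Longrightarrow> Re (v $ i) = a * Re (x $ i)"
    using irreducible_positive_eigenvector_unique[OF B n x_real(2) Re[OF x(1,3)] Re[OF v]]
    by blast
  obtain b where b: "\<And>i. i < n \<Longrightarrow> Im (v $ i) = b * Re (x $ i)"
    using irreducible_positive_eigenvector_unique[OF B n x_real(2) Re[OF x(1,3)] Im[OF v]]
    by blast
  have "v = Complex a b \<cdot>\<^sub>v x"
    using x v by (intro eq_vecI) (auto simp: complex_eq_iff a b x_real)
  then show ?thesis ..
qed

text \<open>
Comparing the first entries of \<open>B x\<close> and \<open>\<mu> x\<close> gives that \<open>\<mu>\<close> is real and nonnegative. If \<open>\<mu>\<close> were
zero, positivity of \<open>x\<close> would force \<open>B = 0\<close>, which is not irreducible: in size one by convention,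
and in larger size because any single index splits off.
\<close>

lemma positive_eigenvector_eigenvalue_pos:
  assumes B: "B \<in> carrier_mat n n" "nonneg_mat B" "irreducible_mat B" and n: "0 < n"
    and x: "x \<in> carrier_vec n" "pos_vec x" "B *\<^sub>v x = \<mu> \<cdot>\<^sub>v x"
  shows "\<mu> \<in> \<real>" "0 < Re \<mu>"
proof -
  have B_entry: "Im (B $$ (i, j)) = 0" "0 \<le> Re (B $$ (i, j))" if "i < n" "j < n" for i j
    using B that by (auto simp: nonneg_mat_def complex_is_Real_iff)
  have x_entry: "Im (x $ i) = 0" "0 < Re (x $ i)" if "i < n" for i
    using x that by (auto simp: pos_vec_def complex_is_Real_iff)
  have entry: "(\<Sum>j<n. B $$ (i, j) * x $ j) = \<mu> * x $ i" if "i < n" for i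
    using index_mult_mat_vec_sum[OF B(1) x(1) that] x that by simp
  have Re: "(\<Sum>j<n. Re (B $$ (i, j)) * Re (x $ j)) = Re \<mu> * Re (x $ i)" if "i < n" for i
    using arg_cong[OF entry[OF that], of Re] that by (simp add: B_entry x_entry)
  have "Im \<mu> * Re (x $ 0) = 0"
    using arg_cong[OF entry[OF n], of Im] n by (simp add: B_entry x_entry)
  then show "\<mu> \<in> \<real>" using x_entry(2)[OF n] by (simp add: complex_is_Real_iff)
  have terms: "0 \<le> Re (B $$ (i, j)) * Re (x $ j)" if "i < n" "j < n" for i j
    using B_entry x_entry that by (simp add: less_imp_le)
  have "0 \<le> Re \<mu> * Re (x $ 0)"
    unfolding Re[OF n, symmetric] using terms n by (auto intro: sum_nonneg)
  then have "0 \<le> Re \<mu>" using x_entry(2)[OF n] by (simp add: zero_le_mult_iff)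
  moreover have "Re \<mu> \<noteq> 0"
  proof
    assume zero: "Re \<mu> = 0"
    have B0: "B $$ (i, j) = 0" if ij: "i < n" "j < n" for i j
    proof -
      have "Re (B $$ (i, j)) * Re (x $ j) = 0"
        using sum_nonneg_0[of "{..<n}" "\<lambda>k. Re (B $$ (i, k)) * Re (x $ k)" j]
          Re[OF ij(1)] zero terms ij by simp
      then show ?thesis using x_entry[OF ij(2)] B_entry[OF ij] by (simp add: complex_eq_iff)
    qed
    show False
    proof (cases "n = 1")
      case True
      then have "B = 0\<^sub>m 1 1" using B(1) B0 by (intro eq_matI) auto
      then show False using B(3) by (simp add: irreducible_mat_def)
    next
      case False
      then have "1 \<in> {..<n}" using n by simp
      then have "{0} \<noteq> {..<n}" by (metis singletonD zero_neq_one)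
      then have "reducible_mat B"
        using n B0 by (intro reducible_mat_if_closed_index_set[OF B(1), of "{0}"]) auto
      then show False using B(3) by (simp add: irreducible_mat_def)
    qed
  qed
  ultimately show "0 < Re \<mu>" by simp
qed

section \<open>Powers of a matrix\<close>

lemma smult_mat_mult_vec:
  fixes A :: "'a :: comm_ring_1 mat"
  assumes "A \<in> carrier_mat n n" "v \<in> carrier_vec n"
  shows "(c \<cdot>\<^sub>m A) *\<^sub>v v = c \<cdot>\<^sub>v (A *\<^sub>v v)"
  using assms by (auto intro!: eq_vecI simp: scalar_prod_def sum_distrib_left mult.assoc)

lemma pow_mat_eigenvector:
  fixes A :: "'a :: field mat"
  assumes A: "A \<in> carrier_mat n n" and v: "v \<in> carrier_vec n" "A *\<^sub>v v = \<mu> \<cdot>\<^sub>v v"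
  shows "A ^\<^sub>m k *\<^sub>v v = \<mu> ^ k \<cdot>\<^sub>v v"
proof (induction k)
  case 0
  then show ?case using A v by auto
next
  case (Suc k)
  have "A ^\<^sub>m Suc k *\<^sub>v v = A ^\<^sub>m k *\<^sub>v (\<mu> \<cdot>\<^sub>v v)"
    using A v by (simp add: assoc_mult_mat_vec[of _ n n _ n])
  also have "\<dots> = \<mu> \<cdot>\<^sub>v (A ^\<^sub>m k *\<^sub>v v)"
    using A v by (simp add: mult_mat_vec[of _ n n])
  finally show ?case using Suc v by (simp add: smult_smult_assoc)
qed

lemma pow_mat_smult:
  fixes A :: "'a :: comm_ring_1 mat"
  assumes A: "A \<in> carrier_mat n n"
  shows "(c \<cdot>\<^sub>m A) ^\<^sub>m k = c ^ k \<cdot>\<^sub>m A ^\<^sub>m k"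
proof (induction k)
  case 0
  then show ?case using A by (auto intro!: eq_matI)
next
  case (Suc k)
  have "(c \<cdot>\<^sub>m A) ^\<^sub>m Suc k = (c ^ k \<cdot>\<^sub>m A ^\<^sub>m k) * (c \<cdot>\<^sub>m A)"
    using Suc by simp
  also have "\<dots> = c \<cdot>\<^sub>m (c ^ k \<cdot>\<^sub>m (A ^\<^sub>m k * A))"
    using A by (simp add: mult_smult_distrib[of _ n n _ n] mult_smult_assoc_mat[of _ n n _ n])
  finally show ?case using A by (auto intro!: eq_matI)
qed

section \<open>Bounded powers\<close>

lemma nonneg_mat_mult:
  assumes "M \<in> carrier_mat n n" "N \<in> carrier_mat n n" "nonneg_mat M" "nonneg_mat N"
  shows "nonneg_mat (M * N)"
  unfolding nonneg_mat_def
proof (intro allI impI)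
  fix i j assume "i < dim_row (M * N)" "j < dim_col (M * N)"
  then have ij: "i < n" "j < n" using assms by auto
  have M: "M $$ (i, k) \<in> \<real>" "0 \<le> Re (M $$ (i, k))" "Im (M $$ (i, k)) = 0"
    and N: "N $$ (k, j) \<in> \<real>" "0 \<le> Re (N $$ (k, j))" "Im (N $$ (k, j)) = 0" if "k < n" for k
    using assms ij that by (auto simp: nonneg_mat_def complex_is_Real_iff)
  have "(M * N) $$ (i, j) = (\<Sum>k = 0..<n. M $$ (i, k) * N $$ (k, j))"
    using assms ij by (simp add: scalar_prod_def)
  moreover have "(\<Sum>k = 0..<n. M $$ (i, k) * N $$ (k, j)) \<in> \<real>"
    using M N by (intro sum_in_Reals Reals_mult) auto
  moreover have "0 \<le> Re (\<Sum>k = 0..<n. M $$ (i, k) * N $$ (k, j))"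
    using M N by (auto intro!: sum_nonneg)
  ultimately show "(M * N) $$ (i, j) \<in> \<real> \<and> 0 \<le> Re ((M * N) $$ (i, j))"
    by simp
qed

lemma nonneg_mat_pow:
  assumes "M \<in> carrier_mat n n" "nonneg_mat M"
  shows "nonneg_mat (M ^\<^sub>m k)"
proof (induction k)
  case 0
  then show ?case using assms by (auto simp: nonneg_mat_def)
next
  case (Suc k)
  then show ?case using nonneg_mat_mult[of "M ^\<^sub>m k" n M] assms by simp
qed

text \<open>
In row \<open>i\<close> of \<open>D\<^sup>q x = x\<close> all summands are nonnegative, so each is at most \<open>x i\<close>. Hence the entry
of \<open>D\<^sup>q\<close> at \<open>(i, j)\<close> is at most \<open>x i / x j\<close>, for every \<open>q\<close>.
\<close>

lemma nonneg_positive_fixed_vector_power_bounded: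
  assumes D: "D \<in> carrier_mat n n" "nonneg_mat D"
    and x: "x \<in> carrier_vec n" "pos_vec x" "D *\<^sub>v x = x"
  shows "\<exists>b. \<forall>q. norm_bound (D ^\<^sub>m q) b"
proof -
  \<comment> \<open>The bounding matrix is only used to name one number above all the quotients.\<close>
  define X where "X = mat n n (\<lambda>(i, j). x $ i / x $ j)"
  obtain b where b: "norm_bound X b" using norm_bound_max by blast
  have x_entry: "Im (x $ i) = 0" "0 < Re (x $ i)" if "i < n" for i
    using x that by (auto simp: pos_vec_def complex_is_Real_iff complex_eq_iff)
  have "norm_bound (D ^\<^sub>m q) b" for q
  proof (rule norm_boundI)
    fix i j assume "i < dim_row (D ^\<^sub>m q)" "j < dim_col (D ^\<^sub>m q)"
    moreover have pow: "D ^\<^sub>m q \<in> carrier_mat n n" using D by simp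
    ultimately have ij: "i < n" "j < n" by (simp_all only: carrier_matD[OF pow])
    have entry: "Im ((D ^\<^sub>m q) $$ (i, k)) = 0" "0 \<le> Re ((D ^\<^sub>m q) $$ (i, k))" if "k < n" for k
      using nonneg_mat_pow[OF D, of q] pow ij that
      by (auto simp: nonneg_mat_def complex_is_Real_iff carrier_matD[OF pow] simp del: pow_mat_dim)
    have "D ^\<^sub>m q *\<^sub>v x = x" using pow_mat_eigenvector[OF D(1) x(1), of 1 q] x by simp
    then have "(\<Sum>k<n. (D ^\<^sub>m q) $$ (i, k) * x $ k) = x $ i"
      using index_mult_mat_vec_sum[OF pow x(1) ij(1)] by simp
    from arg_cong[OF this, of Re] have "(\<Sum>k<n. Re ((D ^\<^sub>m q) $$ (i, k)) * Re (x $ k)) = Re (x $ i)"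
      by (simp add: x_entry(1))
    moreover have "Re ((D ^\<^sub>m q) $$ (i, j)) * Re (x $ j)
        \<le> (\<Sum>k<n. Re ((D ^\<^sub>m q) $$ (i, k)) * Re (x $ k))"
      using ij entry x_entry by (intro member_le_sum) (auto simp: less_imp_le)
    ultimately have "Re ((D ^\<^sub>m q) $$ (i, j)) \<le> Re (x $ i) / Re (x $ j)"
      using x_entry ij by (simp add: field_simps)
    also have "\<dots> = norm (X $$ (i, j))"
      using x_entry[OF ij(1)] x_entry[OF ij(2)] ij by (simp add: X_def norm_divide cmod_eq_Re)
    also have "\<dots> \<le> b" using b ij by (simp add: norm_bound_def X_def)
    finally show "norm ((D ^\<^sub>m q) $$ (i, j)) \<le> b"
      using entry ij by (simp add: cmod_eq_Re)
  qed
  then show ?thesis by blast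
qed

lemma pow_mat_div_mod:
  fixes C :: "'a :: semiring_1 mat"
  assumes C: "C \<in> carrier_mat n n"
  shows "C ^\<^sub>m s = (C ^\<^sub>m m) ^\<^sub>m (s div m) * C ^\<^sub>m (s mod m)"
proof -
  interpret R: semiring "ring_mat TYPE('a) n ()" by (rule semiring_mat)
  have C': "C \<in> carrier (ring_mat TYPE('a) n ())" using C by (simp add: ring_mat_simps)
  have "C ^\<^sub>m s = C [^]\<^bsub>ring_mat TYPE('a) n ()\<^esub> (m * (s div m) + s mod m)"
    using pow_mat_ring_pow[OF C] by simp
  also have "\<dots> = (C [^]\<^bsub>ring_mat TYPE('a) n ()\<^esub> m) [^]\<^bsub>ring_mat TYPE('a) n ()\<^esub> (s div m)
      * C [^]\<^bsub>ring_mat TYPE('a) n ()\<^esub> (s mod m)"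
    using R.nat_pow_mult[OF C', of "m * (s div m)" "s mod m"] C'
    by (simp add: R.nat_pow_pow ring_mat_simps del: mult_div_mod_eq)
  finally show ?thesis using pow_mat_ring_pow[OF C, where b = "()"] pow_mat_ring_pow[OF pow_carrier_mat[OF C], where b = "()"]
    by simp
qed

lemma power_bounded_if_pow_power_bounded:
  fixes C :: "complex mat"
  assumes C: "C \<in> carrier_mat n n" and m: "0 < m"
    and b: "\<And>q. norm_bound ((C ^\<^sub>m m) ^\<^sub>m q) b"
  shows "\<exists>b'. \<forall>s. norm_bound (C ^\<^sub>m s) b'"
proof -
  have "\<exists>c. norm_bound (C ^\<^sub>m t) c" for t using norm_bound_max by blast
  then obtain c where c: "\<And>t. norm_bound (C ^\<^sub>m t) (c t)" by metis
  define c' where "c' = Max (c ` {..<m})"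
  have c': "norm_bound (C ^\<^sub>m t) c'" if "t < m" for t
  proof -
    have "c t \<le> c'" using that by (auto simp: c'_def)
    then show ?thesis using c[of t] unfolding norm_bound_def by (meson order_trans)
  qed
  have "norm_bound (C ^\<^sub>m s) (b * c' * of_nat n)" for s
    unfolding pow_mat_div_mod[OF C, of s m]
    using C b c' m by (intro norm_bound_mult) auto
  then show ?thesis by blast
qed

section \<open>The mean ergodic theorem for matrices with bounded powers\<close>

text \<open>
The kernel hypothesis states that \<open>J\<close> is injective on the fixed space of \<open>C\<close>. With the three
product identities it makes \<open>J\<close> the projection onto this fixed space that commutes with \<open>C\<close>, which
is what allows \<open>I - J\<close> to be written as \<open>(I - C) Z\<close>.
\<close>

lemma cesaro_mean_tendsto_projection:
  fixes C J :: "complex mat"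
  assumes C: "C \<in> carrier_mat n n" and J: "J \<in> carrier_mat n n"
    and CJ: "C * J = J" and JC: "J * C = J" and JJ: "J * J = J"
    and ker: "\<And>v. v \<in> carrier_vec n \<Longrightarrow> C *\<^sub>v v = v \<Longrightarrow> J *\<^sub>v v = 0\<^sub>v n \<Longrightarrow> v = 0\<^sub>v n"
    and bounded: "\<And>s. norm_bound (C ^\<^sub>m s) b"
    and ij: "i < n" "j < n"
  shows "(\<lambda>k. (\<Sum>s\<le>k. (C ^\<^sub>m s) $$ (i, j)) / (1 + of_nat k)) \<longlonglongrightarrow> J $$ (i, j)"
proof -
  \<comment> \<open>On the range of \<open>J\<close> the matrix \<open>N\<close> is the identity, and on the kernel of \<open>J\<close> it is \<open>I - C\<close>,
    which is injective there: adding \<open>J\<close> repairs exactly the defect of \<open>I - C\<close>.\<close>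
  define N where "N = 1\<^sub>m n - C + J"
  have N: "N \<in> carrier_mat n n" using C J by (simp add: N_def)
  have JN: "J * N = J"
  proof -
    have "J * N = J * 1\<^sub>m n - J * C + J * J"
      unfolding N_def using C J
      by (simp add: mult_add_distrib_mat[of _ n n _ n] mult_minus_distrib_mat[of _ n n _ n] minus_carrier_mat)
    also have "\<dots> = J" using J by (auto simp: JC JJ intro!: eq_matI)
    finally show ?thesis .
  qed
  have "det N \<noteq> 0"
  proof
    assume "det N = 0"
    then obtain v where v: "v \<in> carrier_vec n" "v \<noteq> 0\<^sub>v n" "N *\<^sub>v v = 0\<^sub>v n"
      using det_0_iff_vec_prod_zero_field[OF N] by blast
    have "J *\<^sub>v v = (J * N) *\<^sub>v v" by (simp add: JN)
    also have "\<dots> = J *\<^sub>v (N *\<^sub>v v)" using J N v(1) by (rule assoc_mult_mat_vec)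
    also have "\<dots> = 0\<^sub>v n" using J v(3) by auto
    finally have Jv: "J *\<^sub>v v = 0\<^sub>v n" .
    have "N *\<^sub>v v = v - C *\<^sub>v v + J *\<^sub>v v"
      unfolding N_def using C J v
      by (simp add: add_mult_distrib_mat_vec[of _ n n] minus_mult_distrib_mat_vec[of _ n n] minus_carrier_mat)
    then have eq: "v - C *\<^sub>v v + 0\<^sub>v n = 0\<^sub>v n" using v Jv by simp
    have "C *\<^sub>v v = v"
    proof (rule eq_vecI)
      fix i assume "i < dim_vec v"
      then show "(C *\<^sub>v v) $ i = v $ i"
        using arg_cong[OF eq, of "\<lambda>w. w $ i"] v C by simp
    qed (use C v in auto)
    with ker v Jv show False by blast
  qed
  then obtain Z where Z: "Z \<in> carrier_mat n n" and NZ: "N * Z = 1\<^sub>m n"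
    using det_non_zero_imp_unit[OF N, of "()"] by (auto simp: Units_def ring_mat_simps)
  have "J * Z = J * (N * Z)" using assoc_mult_mat[OF J N Z] by (simp add: JN)
  then have JZ: "J * Z = J" using NZ J by simp
  have Z_eq: "Z - C * Z + J = 1\<^sub>m n"
    using NZ C J Z unfolding N_def
    by (simp add: add_mult_distrib_mat[of _ n n _ _ n] minus_mult_distrib_mat[of _ n n _ _ n]
        minus_carrier_mat JZ)
  have powJ: "C ^\<^sub>m s * J = J" for s
  proof (induction s)
    case (Suc s)
    then show ?case using C J CJ by (simp add: assoc_mult_mat[of _ n n _ n _ n])
  qed (use C J in simp)
  \<comment> \<open>This is \<open>C\<^sup>s\<close> times \<open>Z_eq\<close>; it expresses \<open>C\<^sup>s - J\<close> as a difference of consecutive terms.\<close>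
  have step: "(C ^\<^sub>m s) $$ (i, j)
      = J $$ (i, j) - ((C ^\<^sub>m Suc s * Z) $$ (i, j) - (C ^\<^sub>m s * Z) $$ (i, j))" for s
  proof -
    have P: "C ^\<^sub>m s \<in> carrier_mat n n" using C by simp
    have "C ^\<^sub>m s = C ^\<^sub>m s * (Z - C * Z + J)" using right_mult_one_mat[OF P] by (simp add: Z_eq)
    also have "\<dots> = C ^\<^sub>m s * Z - C ^\<^sub>m s * (C * Z) + C ^\<^sub>m s * J"
      using P C Z J
      by (simp add: mult_add_distrib_mat[of _ n n _ n] mult_minus_distrib_mat[of _ n n _ n] minus_carrier_mat)
    also have "\<dots> = C ^\<^sub>m s * Z - C ^\<^sub>m Suc s * Z + J"
      using P C Z by (simp add: powJ assoc_mult_mat[of _ n n _ n _ n])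
    finally have "(C ^\<^sub>m s) $$ (i, j) = (C ^\<^sub>m s * Z - C ^\<^sub>m Suc s * Z + J) $$ (i, j)"
      by (rule arg_cong)
    then show ?thesis using ij P C Z J by (simp del: pow_mat.simps index_mult_mat(1))
  qed
  have sum: "(\<Sum>s\<le>k. (C ^\<^sub>m s) $$ (i, j))
      = (1 + of_nat k) * J $$ (i, j) + (Z $$ (i, j) - (C ^\<^sub>m Suc k * Z) $$ (i, j))" for k
  proof -
    have "(\<Sum>s\<le>k. (C ^\<^sub>m s) $$ (i, j)) = (1 + of_nat k) * J $$ (i, j)
        - (\<Sum>s\<le>k. (C ^\<^sub>m Suc s * Z) $$ (i, j) - (C ^\<^sub>m s * Z) $$ (i, j))"
      by (subst step) (simp add: sum_subtractf del: pow_mat.simps index_mult_mat(1))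
    also have "(\<Sum>s\<le>k. (C ^\<^sub>m Suc s * Z) $$ (i, j) - (C ^\<^sub>m s * Z) $$ (i, j))
        = (C ^\<^sub>m Suc k * Z) $$ (i, j) - (C ^\<^sub>m 0 * Z) $$ (i, j)"
      using sum_lessThan_telescope[of "\<lambda>s. (C ^\<^sub>m s * Z) $$ (i, j)" "Suc k"]
      by (simp only: lessThan_Suc_atMost)
    also have "C ^\<^sub>m 0 * Z = Z" using C Z by simp
    finally show ?thesis by simp
  qed
  obtain z where z: "norm_bound Z z" using norm_bound_max by blast
  define K where "K = norm (Z $$ (i, j)) + b * z * n"
  have rest: "norm (Z $$ (i, j) - (C ^\<^sub>m Suc k * Z) $$ (i, j)) \<le> K" for k
  proof -
    have "norm_bound (C ^\<^sub>m Suc k * Z) (b * z * of_nat n)"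
      using C Z z by (intro norm_bound_mult[OF _ _ bounded]) auto
    then have "norm ((C ^\<^sub>m Suc k * Z) $$ (i, j)) \<le> b * z * n"
      using ij C Z unfolding norm_bound_def by simp
    then show ?thesis
      unfolding K_def by (rule order_trans[OF norm_triangle_ineq4 add_left_mono])
  qed
  have "(\<lambda>k. (Z $$ (i, j) - (C ^\<^sub>m Suc k * Z) $$ (i, j)) / (1 + of_nat k)) \<longlonglongrightarrow> 0"
  proof (rule tendsto_0_le[OF LIMSEQ_inverse_real_of_nat always_eventually], rule allI)
    fix k
    have "norm (1 + of_nat k :: complex) = real (Suc k)"
      using norm_of_nat[of "Suc k", where ?'a = complex] by simp
    then have "norm ((Z $$ (i, j) - (C ^\<^sub>m Suc k * Z) $$ (i, j)) / (1 + of_nat k))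
        \<le> K / real (Suc k)"
      using rest[of k]
      by (simp add: norm_divide divide_right_mono del: pow_mat.simps index_mult_mat(1) of_nat_Suc)
    then show "norm ((Z $$ (i, j) - (C ^\<^sub>m Suc k * Z) $$ (i, j)) / (1 + of_nat k))
        \<le> norm (inverse (real (Suc k))) * K"
      by (simp add: divide_inverse mult.commute del: pow_mat.simps index_mult_mat(1) of_nat_Suc)
  qed
  then have "(\<lambda>k. J $$ (i, j) + (Z $$ (i, j) - (C ^\<^sub>m Suc k * Z) $$ (i, j)) / (1 + of_nat k))
      \<longlonglongrightarrow> J $$ (i, j) + 0"
    by (intro tendsto_intros)
  moreover have "(\<Sum>s\<le>k. (C ^\<^sub>m s) $$ (i, j)) / (1 + of_nat k)
      = J $$ (i, j) + (Z $$ (i, j) - (C ^\<^sub>m Suc k * Z) $$ (i, j)) / (1 + of_nat k)" for k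
  proof -
    have "(1 + of_nat k :: complex) \<noteq> 0" by (metis of_nat_Suc of_nat_neq_0)
    then show ?thesis unfolding sum
      by (simp add: add_divide_distrib del: pow_mat.simps index_mult_mat(1))
  qed
  ultimately show ?thesis by simp
qed

section \<open>The Cesaro means of a power nonnegative matrix\<close>

lemma index_mat_sum:
  assumes "finite S" "\<And>s. s \<in> S \<Longrightarrow> F s \<in> carrier_mat n n" "i < n" "j < n"
  shows "mat_sum n F S \<in> carrier_mat n n" "mat_sum n F S $$ (i, j) = (\<Sum>s\<in>S. F s $$ (i, j))"
proof -
  interpret M: abelian_group "module_mat TYPE(complex) n n" by (rule abelian_group_mat)
  have closed: "mat_sum n F T \<in> carrier_mat n n" if "T \<subseteq> S" for T
    using M.finsum_closed[of F T] assms(2) that by (auto simp: module_mat_simps)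
  then show "mat_sum n F S \<in> carrier_mat n n" by simp
  have "mat_sum n F T $$ (i, j) = (\<Sum>s\<in>T. F s $$ (i, j))" if "T \<subseteq> S" for T
    using finite_subset[OF that assms(1)] that
  proof (induction T rule: finite_induct)
    case empty
    then show ?case using assms by (simp add: module_mat_simps)
  next
    case (insert s T)
    then have "F \<in> T \<rightarrow> carrier_mat n n" "F s \<in> carrier_mat n n" using assms(2) by auto
    then have "mat_sum n F (insert s T) = F s + mat_sum n F T"
      using M.finsum_insert[of T s F] insert by (simp add: module_mat_simps)
    then show ?case using insert closed[of T] assms by simp
  qed
  then show "mat_sum n F S $$ (i, j) = (\<Sum>s\<in>S. F s $$ (i, j))" by simp
qed

theorem theorem3p7:
  fixes A :: "complex mat" and n m :: nat and x y :: "complex Matrix.vec"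
  assumes "0 < n" and "A \<in> carrier_mat n n"
    and "power_nonneg A"
    and "nu A \<le> m" and "nonneg_mat (A ^\<^sub>m m)" and "irreducible_mat (A ^\<^sub>m m)"
    and "x \<in> carrier_vec n" and "pos_vec x"
    and "y \<in> carrier_vec n" and "pos_vec y"
    and "A *\<^sub>v x = lambda1 m A \<cdot>\<^sub>v x"
    and "mat_of_row y * A = lambda1 m A \<cdot>\<^sub>m mat_of_row y"
  shows "mat_tendsto
           (\<lambda>k. (1 / (1 + of_nat k)) \<cdot>\<^sub>m
                  mat_sum n (\<lambda>s. inverse (lambda1 m A ^ s) \<cdot>\<^sub>m (A ^\<^sub>m s)) {0..k})
           ((1 / scalar_prod x y) \<cdot>\<^sub>m outer_mat x y)
       \<and> pos_mat ((1 / scalar_prod x y) \<cdot>\<^sub>m outer_mat x y)"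
proof -
  note n = assms(1) and A = assms(2) and x = assms(7,8) and y = assms(9,10)
    and Ax = assms(11) and yA = assms(12)
  define l where "l = lambda1 m A"
  define C where "C = inverse l \<cdot>\<^sub>m A"
  define \<alpha> where "\<alpha> = 1 / scalar_prod x y"
  define J where "J = \<alpha> \<cdot>\<^sub>m outer_mat x y"
  have C: "C \<in> carrier_mat n n" using A by (simp add: C_def)
  have outer: "outer_mat x y = mat n n (\<lambda>(i, j). x $ i * y $ j)"
    using x y by (intro eq_matI) (auto simp: outer_mat_def scalar_prod_def mat_of_cols_def)
  have J: "J \<in> carrier_mat n n" by (simp add: J_def outer)
  have J_index: "J $$ (i, j) = \<alpha> * (x $ i * y $ j)" if "i < n" "j < n" for i j
    using that by (simp add: J_def outer)

  have x_entry: "Im (x $ i) = 0" "0 < Re (x $ i)" if "i < n" for i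
    using x that by (auto simp: pos_vec_def complex_is_Real_iff)
  have y_entry: "Im (y $ i) = 0" "0 < Re (y $ i)" if "i < n" for i
    using y that by (auto simp: pos_vec_def complex_is_Real_iff)
  have xy_sum: "scalar_prod x y = (\<Sum>k<n. x $ k * y $ k)"
    using x y by (auto simp: scalar_prod_def lessThan_atLeast0 intro!: sum.cong)
  have "Im (scalar_prod x y) = 0" by (simp add: xy_sum x_entry y_entry)
  moreover have "0 < Re (scalar_prod x y)"
    unfolding xy_sum Re_sum using n x_entry y_entry by (intro sum_pos) auto
  ultimately have \<alpha>: "Im \<alpha> = 0" "0 < Re \<alpha>" and xy: "scalar_prod x y \<noteq> 0"
    by (auto simp: \<alpha>_def Re_divide Im_divide)

  \<comment> \<open>The exponent is nonzero, so that \<open>\<lambda>\<^sup>m > 0\<close> excludes \<open>\<lambda> = 0\<close>.\<close>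
  have "1 \<le> nu A"
    using assms(3) LeastI_ex[of "\<lambda>k. 1 \<le> k \<and> nonneg_mat (A ^\<^sub>m k)"]
    by (auto simp: power_nonneg_def nu_def)
  then have m: "0 < m" using assms(4) by simp

  have Am: "A ^\<^sub>m m \<in> carrier_mat n n" using A by simp
  have Amx: "A ^\<^sub>m m *\<^sub>v x = l ^ m \<cdot>\<^sub>v x"
    using pow_mat_eigenvector[OF A x(1), of l m] Ax by (simp add: l_def)
  have lm: "l ^ m \<in> \<real>" "0 < Re (l ^ m)"
    using positive_eigenvector_eigenvalue_pos[OF Am assms(5,6) n x Amx] .
  then have l: "l \<noteq> 0" using m by (auto simp: power_0_left)
  obtain \<mu> where \<mu>: "l ^ m = complex_of_real \<mu>" "0 < \<mu>" using lm by (auto elim: Reals_cases)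

  have Cx: "C *\<^sub>v x = x"
    using Ax A x l by (auto simp: C_def l_def[symmetric] smult_mat_mult_vec[OF A] smult_smult_assoc)
  have yC: "(\<Sum>k<n. y $ k * C $$ (k, j)) = y $ j" if j: "j < n" for j
  proof -
    have "(mat_of_row y * A) $$ (0, j) = (l \<cdot>\<^sub>m mat_of_row y) $$ (0, j)"
      using yA by (simp add: l_def)
    then have "(\<Sum>k<n. y $ k * A $$ (k, j)) = l * y $ j"
      using A y j by (simp add: scalar_prod_def lessThan_atLeast0)
    moreover have "(\<Sum>k<n. y $ k * C $$ (k, j)) = inverse l * (\<Sum>k<n. y $ k * A $$ (k, j))"
      using A j by (simp add: C_def sum_distrib_left mult.left_commute)
    ultimately show ?thesis using l by simp
  qed
  have Jv: "J *\<^sub>v v = (\<alpha> * scalar_prod y v) \<cdot>\<^sub>v x" if v: "v \<in> carrier_vec n" for v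
  proof (rule eq_vecI)
    fix i assume "i < dim_vec ((\<alpha> * scalar_prod y v) \<cdot>\<^sub>v x)"
    then have i: "i < n" using x by simp
    show "(J *\<^sub>v v) $ i = ((\<alpha> * scalar_prod y v) \<cdot>\<^sub>v x) $ i"
      using i x v index_mult_mat_vec_sum[OF J v i]
      by (simp add: J_index scalar_prod_def lessThan_atLeast0 sum_distrib_left sum_distrib_right mult_ac)
  qed (use J x in auto)
  have yx: "\<alpha> * scalar_prod y x = 1"
    using xy comm_scalar_prod[OF x(1) y(1)] by (simp add: \<alpha>_def)
  have CJ: "C * J = J"
  proof (rule eq_matI)
    fix i j assume "i < dim_row J" "j < dim_col J"
    then have ij: "i < n" "j < n" using J by auto
    have "(C * J) $$ (i, j) = (\<Sum>k<n. C $$ (i, k) * x $ k) * (\<alpha> * y $ j)"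
      using C J ij by (simp add: scalar_prod_def lessThan_atLeast0 J_index sum_distrib_left mult_ac)
    also have "(\<Sum>k<n. C $$ (i, k) * x $ k) = x $ i"
      using index_mult_mat_vec_sum[OF C x(1) ij(1)] Cx by simp
    finally show "(C * J) $$ (i, j) = J $$ (i, j)" using ij by (simp add: J_index mult_ac)
  qed (use C J in auto)
  have JC: "J * C = J"
  proof (rule eq_matI)
    fix i j assume "i < dim_row J" "j < dim_col J"
    then have ij: "i < n" "j < n" using J by auto
    have "(J * C) $$ (i, j) = \<alpha> * x $ i * (\<Sum>k<n. y $ k * C $$ (k, j))"
      using C J ij by (simp add: scalar_prod_def lessThan_atLeast0 J_index sum_distrib_left mult_ac)
    then show "(J * C) $$ (i, j) = J $$ (i, j)" using ij by (simp add: J_index yC mult_ac)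
  qed (use C J in auto)
  have JJ: "J * J = J"
  proof (rule eq_matI)
    fix i j assume "i < dim_row J" "j < dim_col J"
    then have ij: "i < n" "j < n" using J by auto
    have "(J * J) $$ (i, j) = \<alpha> * x $ i * y $ j * (\<alpha> * scalar_prod y x)"
      using J x ij
      by (simp add: scalar_prod_def lessThan_atLeast0 J_index sum_distrib_left mult_ac)
    then show "(J * J) $$ (i, j) = J $$ (i, j)" using ij by (simp add: J_index yx)
  qed (use J in auto)

  have ker: "v = 0\<^sub>v n" if v: "v \<in> carrier_vec n" "C *\<^sub>v v = v" "J *\<^sub>v v = 0\<^sub>v n" for v
  proof -
    have "A *\<^sub>v v = l \<cdot>\<^sub>v (C *\<^sub>v v)"
      using A v(1) l by (auto simp: C_def smult_mat_mult_vec[OF A] smult_smult_assoc)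
    then have "A ^\<^sub>m m *\<^sub>v v = complex_of_real \<mu> \<cdot>\<^sub>v v"
      using pow_mat_eigenvector[OF A v(1), of l m] v(2) \<mu> by simp
    moreover have "A ^\<^sub>m m *\<^sub>v x = complex_of_real \<mu> \<cdot>\<^sub>v x" using Amx \<mu> by simp
    moreover have "\<not> reducible_mat (A ^\<^sub>m m)" using assms(6) by (simp add: irreducible_mat_def)
    ultimately obtain c where c: "v = c \<cdot>\<^sub>v x"
      using irreducible_eigenspace_one_dimensional[OF Am assms(5) _ x _ v(1)] by blast
    \<comment> \<open>As \<open>J\<close> fixes \<open>x\<close>, it fixes \<open>v\<close>, which it also annihilates.\<close>
    have "J *\<^sub>v v = c \<cdot>\<^sub>v (J *\<^sub>v x)" unfolding c using J x by (simp add: mult_mat_vec[of _ n n])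
    also have "\<dots> = v" unfolding c using Jv[OF x(1)] yx by simp
    finally show ?thesis using v(3) by simp
  qed

  have pow_C: "C ^\<^sub>m s = inverse (l ^ s) \<cdot>\<^sub>m A ^\<^sub>m s" for s
    unfolding C_def pow_mat_smult[OF A] by (simp add: power_inverse)
  have "nonneg_mat (C ^\<^sub>m m)"
    using assms(5) Am \<mu> unfolding pow_C nonneg_mat_def
    by (auto simp del: pow_mat_dim simp flip: of_real_inverse)
  moreover have "C ^\<^sub>m m *\<^sub>v x = x" using pow_mat_eigenvector[OF C x(1), of 1 m] Cx by simp
  ultimately obtain b where "\<And>q. norm_bound ((C ^\<^sub>m m) ^\<^sub>m q) b"
    using nonneg_positive_fixed_vector_power_bounded[of "C ^\<^sub>m m" n x] C x by auto
  then obtain b' where b': "\<And>s. norm_bound (C ^\<^sub>m s) b'"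
    using power_bounded_if_pow_power_bounded[OF C m] by blast

  define F where "F k = mat_sum n (\<lambda>s. C ^\<^sub>m s) {0..k}" for k :: nat
  have F: "F k \<in> carrier_mat n n" "F k $$ (i, j) = (\<Sum>s\<le>k. (C ^\<^sub>m s) $$ (i, j))"
    if "i < n" "j < n" for k i j
    using index_mat_sum[of "{0..k}" "\<lambda>s. C ^\<^sub>m s" n i j] C that
    by (simp_all add: F_def atMost_atLeast0)
  have "mat_tendsto (\<lambda>k. (1 / (1 + of_nat k)) \<cdot>\<^sub>m F k) J"
    unfolding mat_tendsto_def
  proof (intro conjI allI impI)
    fix k
    show "(1 / (1 + of_nat k)) \<cdot>\<^sub>m F k \<in> carrier_mat (dim_row J) (dim_col J)"
      using F(1)[OF n n] J by simp
  next
    fix i j assume "i < dim_row J" "j < dim_col J"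
    then have ij: "i < n" "j < n" using J by auto
    have eq: "((1 / (1 + of_nat k)) \<cdot>\<^sub>m F k) $$ (i, j)
        = (\<Sum>s\<le>k. (C ^\<^sub>m s) $$ (i, j)) / (1 + of_nat k)" for k
      using F[OF ij, of k] ij by simp
    show "(\<lambda>k. ((1 / (1 + of_nat k)) \<cdot>\<^sub>m F k) $$ (i, j)) \<longlonglongrightarrow> J $$ (i, j)"
      unfolding eq by (rule cesaro_mean_tendsto_projection[OF C J CJ JC JJ ker b' ij])
  qed
  moreover have "pos_mat J"
    unfolding pos_mat_def
  proof (intro allI impI)
    fix i j assume "i < dim_row J" "j < dim_col J"
    then have ij: "i < n" "j < n" using J by auto
    show "J $$ (i, j) \<in> \<real> \<and> 0 < Re (J $$ (i, j))"
      using x_entry[OF ij(1)] y_entry[OF ij(2)] \<alpha>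
      by (simp add: J_index[OF ij] complex_is_Real_iff)
  qed
  ultimately show ?thesis
    unfolding F_def J_def \<alpha>_def pow_C l_def by (rule conjI)
qed

end
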